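(* Let $\gamma>1$, $\phi=\frac{2}{1+\gamma}$ and $c_0>0$. There exists $R_0>3$ such that for every $R\ge R_0$ the following holds. Let $\lambda\ge c_0$, let the sign $\pm$ be either $+$ or $-$, and let $W_{\lambda,\pm R}:[0,3]\to[0,\infty)$ be a solution, positive on $(0,3]$, of the ODE problem $$W_{\lambda,\pm R}''(t)+\frac{1}{t\pm R}W_{\lambda,\pm R}'(t)=-\left(W_{\lambda,\pm R}(t)\right)^{-\gamma}\ \text{ for }t\in(0,3),\qquad W_{\lambda,\pm R}(3)=\lambda,\qquad W_{\lambda,\pm R}(0)=0.$$ Then $$W_{\lambda,\pm R}(t)\sim\begin{cases}t^{\phi},&\text{if }t\le\lambda^{\frac{1+\gamma}{1-\gamma}},\\ \lambda t,&\text{if }\lambda^{\frac{1+\gamma}{1-\gamma}}\le t\le1,\\ \lambda,&\text{if }1\le t\le3.\end{cases}$$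
   Context: $t$ ranges over $[0,3]$. $q_1\sim q_2$ means $C^{-1}q_2\le q_1\le Cq_2$ with a constant $C>0$ depending only on $(\gamma,c_0,R)$, not on $\lambda$ or $t$. The solution is $C^2$ on $(0,3)$ and continuous on $[0,3]$. *)

theory Defs
  imports "HOL-Analysis.Analysis"
begin

definition comparable :: "real \<Rightarrow> real \<Rightarrow> real \<Rightarrow> bool" where
  "comparable C x y \<longleftrightarrow> inverse C * y \<le> x \<and> x \<le> C * y"

(* The real parameter r stands for the signed radius +R or -R.  The two C1 conditions say
   that W is C^2 on (0,3); the values of W outside [0,3] are irrelevant. *)
definition W_solution :: "real \<Rightarrow> real \<Rightarrow> real \<Rightarrow> (real \<Rightarrow> real) \<Rightarrow> bool" where
  "W_solution \<gamma> lam r W \<longleftrightarrow>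
     continuous_on {0..3} W \<and>
     W C1_differentiable_on {0<..<3} \<and>
     deriv W C1_differentiable_on {0<..<3} \<and>
     (\<forall>t\<in>{0..3}. 0 \<le> W t) \<and>
     (\<forall>t\<in>{0<..3}. 0 < W t) \<and>
     (\<forall>t\<in>{0<..<3}. deriv (deriv W) t + 1 / (t + r) * deriv W t = - (W t powr (- \<gamma>))) \<and>
     W 3 = lam \<and>
     W 0 = 0"

end

theory Submission
  imports Defs
begin

text \<open>
  In the variable \<open>s\<close> given by \<open>t = r (exp (s / r) - 1)\<close> the first-order term disappears: \<open>V s = W t\<close>
  satisfies \<open>V'' = - q V powr (- \<gamma>)\<close> with \<open>q = exp (2 s / r)\<close> bounded above and below, so \<open>V\<close> is concave
  and lies above its chord. Either \<open>V \<le> V s\<close> on \<open>(0, s)\<close>, and then \<open>V'' \<le> - a (V s) powr (- \<gamma>)\<close> there,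
  which tested at the midpoint gives \<open>V s \<ge> c s powr \<phi>\<close>; or \<open>V\<close> already decreases at \<open>s\<close> and
  \<open>V s \<ge> \<lambda>\<close>. Inserting this lower bound into the equation, \<open>V - K s powr \<phi>\<close> is convex for a
  suitable \<open>K\<close>, hence \<open>V s \<le> K s powr \<phi> + \<lambda> s / L\<close>.
  The powers \<open>t powr \<phi>\<close> and \<open>\<lambda> t\<close> cross exactly at \<open>t = \<lambda> powr ((1 + \<gamma>) / (1 - \<gamma>))\<close>.
\<close>

lemma convex_chord:
  fixes f :: "real \<Rightarrow> real"
  assumes cont: "continuous_on {x..y} f"
    and f': "\<And>u. x < u \<Longrightarrow> u < y \<Longrightarrow> (f has_real_derivative f' u) (at u)"
    and f'': "\<And>u. x < u \<Longrightarrow> u < y \<Longrightarrow> (f' has_real_derivative f'' u) (at u)"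
    and nonneg: "\<And>u. x < u \<Longrightarrow> u < y \<Longrightarrow> 0 \<le> f'' u"
    and z: "x < z" "z < y"
  shows "(f z - f x) * (y - z) \<le> (f y - f z) * (z - x)"
proof -
  have mvt: "\<exists>u. p < u \<and> u < w \<and> f w - f p = (w - p) * f' u" if "x \<le> p" "p < w" "w \<le> y" for p w
  proof -
    have "\<exists>D. (f has_real_derivative D) (at v)" if "p < v" "v < w" for v
      using f'[of v] that \<open>x \<le> p\<close> \<open>w \<le> y\<close> by auto
    then have "\<exists>l u. p < u \<and> u < w \<and> (f has_real_derivative l) (at u) \<and> f w - f p = (w - p) * l"
      using that by (intro MVT continuous_on_subset[OF cont])
        (auto simp: real_differentiable_def)
    then show ?thesis
      using f' that DERIV_unique by (smt (verit))
  qed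
  obtain u where u: "x < u" "u < z" "f z - f x = (z - x) * f' u"
    using mvt[of x z] z by auto
  obtain v where v: "z < v" "v < y" "f y - f z = (y - z) * f' v"
    using mvt[of z y] z by auto
  have "f' u \<le> f' v"
  proof (rule DERIV_nonneg_imp_nondecreasing[of u v f'])
    show "u \<le> v" using u v by simp
    fix w assume "u \<le> w" "w \<le> v"
    then have "x < w" "w < y" using u v by auto
    then show "\<exists>D. (f' has_real_derivative D) (at w) \<and> 0 \<le> D"
      using f'' nonneg by blast
  qed
  then have "(z - x) * (y - z) * f' u \<le> (z - x) * (y - z) * f' v"
    using z by (intro mult_left_mono) auto
  then show ?thesis
    unfolding u(3) v(3) by (simp only: ac_simps)
qed

locale concave_profile =
  fixes \<gamma> \<phi> a b L lam :: real and q V V' :: "real \<Rightarrow> real"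
  assumes \<gamma>: "\<gamma> > 1" and \<phi>: "\<phi> = 2 / (1 + \<gamma>)" and a: "a > 0" and L: "L > 0"
    and cont: "continuous_on {0..L} V"
    and V': "\<And>s. 0 < s \<Longrightarrow> s < L \<Longrightarrow> (V has_real_derivative V' s) (at s)"
    and V'': "\<And>s. 0 < s \<Longrightarrow> s < L \<Longrightarrow> (V' has_real_derivative - q s * V s powr (- \<gamma>)) (at s)"
    and q: "\<And>s. 0 < s \<Longrightarrow> s < L \<Longrightarrow> a \<le> q s" "\<And>s. 0 < s \<Longrightarrow> s < L \<Longrightarrow> q s \<le> b"
    and pos: "\<And>s. 0 < s \<Longrightarrow> s \<le> L \<Longrightarrow> 0 < V s"
    and V0: "V 0 = 0" and VL: "V L = lam"
begin

lemma \<phi>01: "0 < \<phi>" "\<phi> < 1"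
  using \<gamma> unfolding \<phi> by (auto simp: field_simps)

lemma concave_chord:
  assumes "0 \<le> x" "x < z" "z < y" "y \<le> L"
  shows "(V y - V z) * (z - x) \<le> (V z - V x) * (y - z)"
proof -
  have "(- V z - - V x) * (y - z) \<le> (- V y - - V z) * (z - x)"
  proof (rule convex_chord[where f' = "\<lambda>s. - V' s" and f'' = "\<lambda>s. q s * V s powr (- \<gamma>)"])
    show "continuous_on {x..y} (\<lambda>s. - V s)"
      using assms by (intro continuous_intros continuous_on_subset[OF cont]) auto
    fix u assume "x < u" "u < y"
    then have u: "0 < u" "u < L" using assms by auto
    show "((\<lambda>s. - V s) has_real_derivative - V' u) (at u)"
      using V'[OF u] by (rule DERIV_minus)
    show "((\<lambda>s. - V' s) has_real_derivative q u * V u powr (- \<gamma>)) (at u)"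
      using DERIV_minus[OF V''[OF u]] by simp
    show "0 \<le> q u * V u powr (- \<gamma>)"
      using q(1)[OF u] a by auto
  qed (use assms in auto)
  then show ?thesis by (simp add: algebra_simps)
qed

lemma chord_lower_bound:
  assumes "0 \<le> s" "s \<le> L"
  shows "lam * s / L \<le> V s"
proof (cases "s = 0 \<or> s = L")
  case True
  then show ?thesis using V0 VL L by auto
next
  case False
  then have "(V L - V s) * (s - 0) \<le> (V s - V 0) * (L - s)"
    using assms by (intro concave_chord) auto
  then show ?thesis using V0 VL L by (simp add: field_simps)
qed

lemma power_lower_bound_local:
  assumes s: "0 < s" "s \<le> L" and max: "\<And>x. 0 < x \<Longrightarrow> x < s \<Longrightarrow> V x \<le> V s"
  shows "(a / 4) powr (1 / (1 + \<gamma>)) * s powr \<phi> \<le> V s"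
proof -
  define k where "k = a * V s powr (- \<gamma>)"
  have Vs: "V s > 0" using pos s by auto
  let ?f = "\<lambda>x. - V x - k * x\<^sup>2 / 2"
  have "(?f (s/2) - ?f 0) * (s - s/2) \<le> (?f s - ?f (s/2)) * (s/2 - 0)"
  proof (rule convex_chord[where f' = "\<lambda>x. - V' x - k * x" and f'' = "\<lambda>x. q x * V x powr (- \<gamma>) - k"])
    show "continuous_on {0..s} ?f"
      using s by (intro continuous_intros continuous_on_subset[OF cont]) auto
    fix u assume us: "0 < u" "u < s"
    then have u: "0 < u" "u < L" using s by auto
    show "(?f has_real_derivative - V' u - k * u) (at u)"
      using V'[OF u] by (auto intro!: derivative_eq_intros)
    show "((\<lambda>x. - V' x - k * x) has_real_derivative q u * V u powr (- \<gamma>) - k) (at u)"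
      using V''[OF u] by (auto intro!: derivative_eq_intros)
    have "V s powr (- \<gamma>) \<le> V u powr (- \<gamma>)"
      using \<gamma> max us pos[of u] u by (intro powr_mono2') auto
    then show "0 \<le> q u * V u powr (- \<gamma>) - k"
      unfolding k_def using q(1)[OF u] a by (simp add: mult_mono)
  qed (use s in auto)
  moreover have "s - s/2 = s/2" "s/2 - 0 = s/2" by auto
  ultimately have "?f (s/2) - ?f 0 \<le> ?f s - ?f (s/2)"
    using s by (simp only: mult_le_cancel_right_pos half_gt_zero)
  then have "V s / 2 + k * s\<^sup>2 / 8 \<le> V (s/2)"
    using V0 by (simp add: power2_eq_square)
  also have "\<dots> \<le> V s" using max s by auto
  finally have "k * s\<^sup>2 / 4 \<le> V s" by simp
  then have "(a / 4) * s\<^sup>2 * V s powr (- \<gamma>) * V s powr \<gamma> \<le> V s * V s powr \<gamma>"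
    unfolding k_def by (intro mult_right_mono) (auto simp: algebra_simps)
  moreover have "V s powr (- \<gamma>) * V s powr \<gamma> = 1" "V s * V s powr \<gamma> = V s powr (1 + \<gamma>)"
    using Vs by (simp_all add: powr_minus powr_add)
  ultimately have "(a / 4) * s\<^sup>2 \<le> V s powr (1 + \<gamma>)"
    by (simp only: mult.assoc mult_1_right)
  then have "((a / 4) * s\<^sup>2) powr (1 / (1 + \<gamma>)) \<le> (V s powr (1 + \<gamma>)) powr (1 / (1 + \<gamma>))"
    using a \<gamma> by (intro powr_mono2) auto
  moreover have "((a / 4) * s\<^sup>2) powr (1 / (1 + \<gamma>)) =
      (a / 4) powr (1 / (1 + \<gamma>)) * (s\<^sup>2) powr (1 / (1 + \<gamma>))"
    by (rule powr_mult)
  moreover have "(s\<^sup>2) powr (1 / (1 + \<gamma>)) = s powr \<phi>"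
    using s \<phi> powr_powr[of s 2 "1 / (1 + \<gamma>)"] by (simp add: powr_numeral)
  ultimately show ?thesis
    using \<gamma> Vs by (simp add: powr_powr)
qed

lemma power_lower_bound:
  assumes "0 \<le> s" "s \<le> L" and M: "L \<le> M" and c0: "0 < c0" "c0 \<le> lam"
    and c: "c \<le> (a / 4) powr (1 / (1 + \<gamma>))" "c \<le> c0 / M powr \<phi>"
  shows "c * s powr \<phi> \<le> V s"
proof (cases "s = 0")
  case True
  then show ?thesis using V0 by simp
next
  case False
  then have s: "0 < s" "s \<le> L" using assms by auto
  show ?thesis
  proof (cases "\<forall>x. 0 < x \<longrightarrow> x < s \<longrightarrow> V x \<le> V s")
    case True
    have "c * s powr \<phi> \<le> (a / 4) powr (1 / (1 + \<gamma>)) * s powr \<phi>"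
      using c by (intro mult_right_mono) auto
    also have "\<dots> \<le> V s" using True s by (intro power_lower_bound_local) auto
    finally show ?thesis .
  next
    case False
    then obtain x where x: "0 < x" "x < s" "V s < V x" by force
    have "lam \<le> V s"
    proof (cases "s = L")
      case False
      then have "(V L - V s) * (s - x) \<le> (V s - V x) * (L - s)"
        using x s by (intro concave_chord) auto
      also have "\<dots> \<le> 0" using x s by (intro mult_nonpos_nonneg) auto
      finally show ?thesis using x VL by (simp add: mult_le_0_iff)
    qed (use VL in auto)
    moreover have "c * s powr \<phi> \<le> c0 / M powr \<phi> * s powr \<phi>"
      using c by (intro mult_right_mono) auto
    moreover have "c0 / M powr \<phi> * s powr \<phi> \<le> c0 / M powr \<phi> * M powr \<phi>"
      using s M c0 \<phi>01 by (intro mult_left_mono powr_mono2) auto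
    moreover have "M > 0" using L M by auto
    ultimately show ?thesis using c0 by simp
  qed
qed

lemma power_upper_bound:
  assumes s: "0 \<le> s" "s \<le> L" and c: "0 < c"
    and lower: "\<And>x. 0 < x \<Longrightarrow> x < L \<Longrightarrow> c * x powr \<phi> \<le> V x"
  shows "V s \<le> b * c powr (- \<gamma>) / (\<phi> * (1 - \<phi>)) * s powr \<phi> + lam * s / L"
proof (cases "s = 0 \<or> s = L")
  case True
  have "0 \<le> b" using q[of "L / 2"] a L by auto
  then show ?thesis using True V0 VL L \<phi>01 by auto
next
  case False
  then have s: "0 < s" "s < L" using s by auto
  define K where "K = b * c powr (- \<gamma>) / (\<phi> * (1 - \<phi>))"
  have b: "0 \<le> b" using q[of "L / 2"] a L by auto
  then have K: "0 \<le> K" unfolding K_def using \<phi>01 by auto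
  have exponent: "\<phi> * (- \<gamma>) = \<phi> - 1 - 1"
    using \<gamma> unfolding \<phi> by (simp add: field_simps)
  let ?f = "\<lambda>x. V x - K * x powr \<phi>"
  have "(?f s - ?f 0) * (L - s) \<le> (?f L - ?f s) * (s - 0)"
  proof (rule convex_chord[where f' = "\<lambda>x. V' x - K * (\<phi> * x powr (\<phi> - 1))"
        and f'' = "\<lambda>x. - q x * V x powr (- \<gamma>) - K * (\<phi> * ((\<phi> - 1) * x powr (\<phi> - 1 - 1)))"])
    show "continuous_on {0..L} ?f"
      using \<phi>01 by (intro continuous_intros continuous_on_powr' cont) auto
    fix u assume u: "0 < u" "u < L"
    show "(?f has_real_derivative V' u - K * (\<phi> * u powr (\<phi> - 1))) (at u)"
      using V'[OF u] u
      by (intro DERIV_diff DERIV_cmult has_real_derivative_powr) auto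
    show "((\<lambda>x. V' x - K * (\<phi> * x powr (\<phi> - 1))) has_real_derivative
        - q u * V u powr (- \<gamma>) - K * (\<phi> * ((\<phi> - 1) * u powr (\<phi> - 1 - 1)))) (at u)"
      using V''[OF u] u
      by (intro DERIV_diff DERIV_cmult has_real_derivative_powr) auto
    have "V u powr (- \<gamma>) \<le> (c * u powr \<phi>) powr (- \<gamma>)"
      using lower[OF u] c u \<gamma> by (intro powr_mono2') auto
    also have "\<dots> = c powr (- \<gamma>) * u powr (\<phi> - 1 - 1)"
      using c u exponent by (simp add: powr_mult powr_powr del: mult_minus_right)
    finally have "q u * V u powr (- \<gamma>) \<le> b * (c powr (- \<gamma>) * u powr (\<phi> - 1 - 1))"
      using q[OF u] a b by (intro mult_mono) auto
    also have "\<dots> = K * (\<phi> * (1 - \<phi>)) * u powr (\<phi> - 1 - 1)"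
      unfolding K_def using \<phi>01 by simp
    finally show "0 \<le> - q u * V u powr (- \<gamma>) - K * (\<phi> * ((\<phi> - 1) * u powr (\<phi> - 1 - 1)))"
      by (simp add: algebra_simps)
  qed (use s in auto)
  then have "?f s * L \<le> ?f L * s"
    using V0 by (simp add: algebra_simps)
  also have "\<dots> \<le> lam * s"
    using VL K s by (intro mult_right_mono) auto
  finally have "?f s \<le> lam * s / L" using L by (simp add: field_simps)
  then show ?thesis unfolding K_def by simp
qed

end

lemma W_solution_derivs:
  assumes "W_solution \<gamma> lam r W" "0 < t" "t < 3"
  shows "(W has_real_derivative deriv W t) (at t)"
    and "(deriv W has_real_derivative - (W t powr (- \<gamma>)) - deriv W t / (t + r)) (at t)"
proof -
  have "W differentiable at t" "deriv W differentiable at t"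
    using assms unfolding W_solution_def
    by (auto simp: C1_differentiable_on_eq)
  then have *: "(W has_real_derivative deriv W t) (at t)"
    "(deriv W has_real_derivative deriv (deriv W) t) (at t)"
    by (metis DERIV_imp_deriv real_differentiable_def)+
  moreover have "deriv (deriv W) t + 1 / (t + r) * deriv W t = - (W t powr (- \<gamma>))"
    using assms unfolding W_solution_def by auto
  then have "deriv (deriv W) t = - (W t powr (- \<gamma>)) - deriv W t / (t + r)" by simp
  ultimately show "(W has_real_derivative deriv W t) (at t)"
    and "(deriv W has_real_derivative - (W t powr (- \<gamma>)) - deriv W t / (t + r)) (at t)"
    by auto
qed

lemma W_solution_bounds:
  fixes \<gamma> \<phi> c0 :: real
  assumes \<gamma>: "\<gamma> > 1" and \<phi>: "\<phi> = 2 / (1 + \<gamma>)" and c0: "c0 > 0"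
  obtains c K where "c > 0" "K > 0"
    "\<And>lam r W t. \<lbrakk>W_solution \<gamma> lam r W; lam \<ge> c0; \<bar>r\<bar> \<ge> 6; 0 \<le> t; t \<le> 3\<rbrakk> \<Longrightarrow>
       c * t powr \<phi> \<le> W t \<and> lam * t / 9 \<le> W t \<and> W t \<le> K * t powr \<phi> + lam * t"
proof -
  define d where "d = min ((1 / 4 / 4) powr (1 / (1 + \<gamma>))) (c0 / 6 powr \<phi>)"
  define M where "M = 9 / 4 * d powr (- \<gamma>) / (\<phi> * (1 - \<phi>))"
  have \<phi>01: "0 < \<phi>" "\<phi> < 1" using \<gamma> unfolding \<phi> by (auto simp: field_simps)
  have d: "d > 0" unfolding d_def using c0 by auto
  have M: "M > 0" unfolding M_def using \<phi>01 d by auto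
  show thesis
  proof (rule that[of "d * (2 / 3) powr \<phi>" "M * 2 powr \<phi>"])
    show "d * (2 / 3) powr \<phi> > 0" "M * 2 powr \<phi> > 0" using d M by auto
    fix lam r t :: real and W
    assume W: "W_solution \<gamma> lam r W" and lam: "lam \<ge> c0" and r: "\<bar>r\<bar> \<ge> 6"
      and t: "0 \<le> t" "t \<le> 3"
    define g where "g = (\<lambda>s. r * (exp (s / r) - 1))"
    define h where "h = (\<lambda>x. r * ln (1 + x / r))"
    define L where "L = h 3"
    have r0: "r \<noteq> 0" using r by auto
    have ratio: "1 / 2 \<le> 1 + x / r \<and> 1 + x / r \<le> 3 / 2" if "0 \<le> x" "x \<le> 3" for x
    proof -
      have "\<bar>x / r\<bar> \<le> 1 / 2" using r that by (simp add: abs_divide field_simps)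
      then show ?thesis unfolding abs_le_iff by linarith
    qed
    have gh: "g (h x) = x" if "0 \<le> x" "x \<le> 3" for x
    proof -
      have "0 < 1 + x / r" using ratio[OF that] by linarith
      then show ?thesis using r0 unfolding g_def h_def by simp
    qed
    have g0: "g 0 = 0" unfolding g_def by simp
    have dg: "(g has_real_derivative exp (s / r)) (at s)" for s
      unfolding g_def using r0 by (auto intro!: derivative_eq_intros)
    have g_less: "g x < g y" if "x < y" for x y
      using that dg by (intro DERIV_pos_imp_increasing[of x y g]) (auto intro!: exI)
    have h0: "h x > 0" if "0 < x" "x \<le> 3" for x
    proof (rule ccontr)
      assume "\<not> ?thesis"
      then have "g (h x) \<le> g 0" using g_less[of "h x" 0] by (cases "h x = 0") auto
      then show False using gh that g0 by auto
    qed
    have gL: "g L = 3" unfolding L_def using gh by simp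
    have L: "L > 0" unfolding L_def using h0 by simp
    have exp_range: "1 / 2 \<le> exp (s / r) \<and> exp (s / r) \<le> 3 / 2" if "0 \<le> s" "s \<le> L" for s
    proof -
      have "0 \<le> g s" "g s \<le> 3"
        using that g_less[of 0 s] g_less[of s L] g0 gL by (cases "s = 0"; cases "s = L"; simp)+
      then show ?thesis using ratio[of "g s"] r0 unfolding g_def by simp
    qed
    have g_range: "s / 2 \<le> g s \<and> g s \<le> 3 / 2 * s" if s: "0 \<le> s" "s \<le> L" for s
    proof (cases "s = 0")
      case False
      then obtain z where "0 < z" "z < s" "g s - g 0 = (s - 0) * exp (z / r)"
        using MVT2[of 0 s g "\<lambda>s. exp (s / r)"] s dg by auto
      moreover from this have "s * (1 / 2) \<le> s * exp (z / r)" "s * exp (z / r) \<le> s * (3 / 2)"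
        using exp_range[of z] s by (auto intro!: mult_left_mono)
      ultimately show ?thesis using g0 by auto
    qed (use g0 in auto)
    have L_range: "2 \<le> L" "L \<le> 6" using g_range[of L] gL L by auto
    have g_in: "0 < g s \<and> g s \<le> 3" if "0 < s" "s \<le> L" for s
      using that g_less[of 0 s] g_less[of s L] g0 gL by (cases "s = L") auto
    interpret concave_profile \<gamma> \<phi> "1 / 4" "9 / 4" L lam "\<lambda>s. (exp (s / r))\<^sup>2"
      "\<lambda>s. W (g s)" "\<lambda>s. deriv W (g s) * exp (s / r)"
    proof
      show "continuous_on {0..L} (\<lambda>s. W (g s))"
      proof (rule continuous_on_compose2[where g = W and f = g])
        show "continuous_on {0..3} W" using W unfolding W_solution_def by auto
        show "continuous_on {0..L} g" unfolding g_def using r0 by (intro continuous_intros) auto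
        show "g ` {0..L} \<subseteq> {0..3}"
          using g_in g0 by (force simp: less_le)
      qed
      show "W (g 0) = 0" "W (g L) = lam" using g0 gL W unfolding W_solution_def by auto
      fix s :: real assume "0 < s"
      {
        assume "s \<le> L"
        then show "0 < W (g s)" using g_in[of s] \<open>0 < s\<close> W unfolding W_solution_def by auto
      }
      assume "s < L"
      have gs: "0 < g s" "g s < 3" using g_in[of s] g_less[of s L] gL \<open>0 < s\<close> \<open>s < L\<close> by auto
      note D = W_solution_derivs[OF W gs]
      show "((\<lambda>s. W (g s)) has_real_derivative deriv W (g s) * exp (s / r)) (at s)"
        using DERIV_chain2[OF D(1) dg] .
      have "((\<lambda>s. exp (s / r)) has_real_derivative exp (s / r) / r) (at s)"
        using r0 by (auto intro!: derivative_eq_intros)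
      note DERIV_mult[OF DERIV_chain2[OF D(2) dg] this]
      moreover have "g s + r = r * exp (s / r)" unfolding g_def by (simp add: algebra_simps)
      then have "deriv W (g s) / (g s + r) * exp (s / r) = deriv W (g s) / r"
        by simp
      then have "(- (W (g s) powr (- \<gamma>)) - deriv W (g s) / (g s + r)) * exp (s / r) * exp (s / r) +
          exp (s / r) / r * deriv W (g s) = - (exp (s / r))\<^sup>2 * W (g s) powr (- \<gamma>)"
        by (simp add: left_diff_distrib power2_eq_square)
      ultimately show "((\<lambda>s. deriv W (g s) * exp (s / r)) has_real_derivative
          - (exp (s / r))\<^sup>2 * W (g s) powr (- \<gamma>)) (at s)"
        by simp
      show "1 / 4 \<le> (exp (s / r))\<^sup>2"
        using power_mono[of "1 / 2" "exp (s / r)" 2] exp_range[of s] \<open>0 < s\<close> \<open>s < L\<close>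
        by (simp add: power2_eq_square)
      show "(exp (s / r))\<^sup>2 \<le> 9 / 4"
        using power_mono[of "exp (s / r)" "3 / 2" 2] exp_range[of s] \<open>0 < s\<close> \<open>s < L\<close>
        by (simp add: power2_eq_square)
    qed (use \<gamma> \<phi> L in auto)
    define s where "s = h t"
    have gs: "g s = t" unfolding s_def using gh t by auto
    have s: "0 \<le> s" "s \<le> L"
    proof -
      show "0 \<le> s" unfolding s_def using h0[of t] t by (cases "t = 0") (auto simp: h_def)
      show "s \<le> L" using g_less[of L s] gs gL t by (cases "s \<le> L") auto
    qed
    have st: "2 / 3 * t \<le> s" "s \<le> 2 * t" using g_range[OF s] gs by auto
    have lower: "d * x powr \<phi> \<le> W (g x)" if "0 \<le> x" "x \<le> L" for x
      using power_lower_bound[of x 6 c0 d] that L_range lam c0 unfolding d_def by auto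
    have "d * (2 / 3) powr \<phi> * t powr \<phi> \<le> W t"
    proof -
      have "d * (2 / 3 * t) powr \<phi> \<le> d * s powr \<phi>"
        using st t d \<phi>01 by (intro mult_left_mono powr_mono2) auto
      also have "\<dots> \<le> W t" using lower[OF s] gs by simp
      finally show ?thesis by (simp only: powr_mult mult.assoc)
    qed
    moreover have "lam * t / 9 \<le> W t"
    proof -
      have "lam * t / 9 \<le> lam * (s / 6)"
        using st lam c0 by simp
      also have "\<dots> \<le> lam * (s / L)"
        using s L L_range lam c0 by (intro mult_left_mono divide_left_mono) auto
      also have "\<dots> \<le> W t" using chord_lower_bound[OF s] gs by simp
      finally show ?thesis .
    qed
    moreover have "W t \<le> M * 2 powr \<phi> * t powr \<phi> + lam * t"
    proof -
      have "W t \<le> M * s powr \<phi> + lam * (s / L)"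
        using power_upper_bound[OF s d] lower gs unfolding M_def by simp
      also have "M * s powr \<phi> \<le> M * (2 * t) powr \<phi>"
        using st s M \<phi>01 by (intro mult_left_mono powr_mono2) auto
      also have "lam * (s / L) \<le> lam * (2 * t / 2)"
        using st t s L L_range lam c0 by (intro mult_left_mono frac_le) auto
      finally show ?thesis by (simp add: powr_mult)
    qed
    ultimately show "d * (2 / 3) powr \<phi> * t powr \<phi> \<le> W t \<and> lam * t / 9 \<le> W t \<and>
        W t \<le> M * 2 powr \<phi> * t powr \<phi> + lam * t"
      by blast
  qed
qed

lemma crossover:
  fixes \<gamma> \<phi> lam t :: real
  assumes \<gamma>: "\<gamma> > 1" and \<phi>: "\<phi> = 2 / (1 + \<gamma>)" and lam: "lam > 0" and t: "t \<ge> 0"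
  shows "t \<le> lam powr ((1 + \<gamma>) / (1 - \<gamma>)) \<Longrightarrow> lam * t \<le> t powr \<phi>"
    and "lam powr ((1 + \<gamma>) / (1 - \<gamma>)) \<le> t \<Longrightarrow> t powr \<phi> \<le> lam * t"
proof -
  let ?T = "lam powr ((1 + \<gamma>) / (1 - \<gamma>))"
  have "\<phi> - 1 = (1 - \<gamma>) / (1 + \<gamma>)"
    using \<gamma> unfolding \<phi> by (simp add: field_simps)
  then have e: "(1 + \<gamma>) / (1 - \<gamma>) * (\<phi> - 1) = 1"
    using \<gamma> by simp
  have T: "?T powr (\<phi> - 1) = lam"
    using lam by (simp add: powr_powr e del: times_divide_eq_left)
  have \<phi>1: "\<phi> - 1 \<le> 0" using \<gamma> unfolding \<phi> by (simp add: field_simps)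
  have split: "t powr \<phi> = t powr (\<phi> - 1) * t" if "t > 0"
    using that powr_add[of t "\<phi> - 1" 1] by simp
  show "lam * t \<le> t powr \<phi>" if "t \<le> ?T"
  proof (cases "t = 0")
    case False
    then have "?T powr (\<phi> - 1) \<le> t powr (\<phi> - 1)"
      using that t \<phi>1 by (intro powr_mono2') auto
    then show ?thesis using T split t False by (simp add: mult_right_mono)
  qed simp
  show "t powr \<phi> \<le> lam * t" if "?T \<le> t"
  proof -
    have "?T > 0" using lam by simp
    then have "t powr (\<phi> - 1) \<le> ?T powr (\<phi> - 1)" "t > 0"
      using that \<phi>1 by (auto intro!: powr_mono2' simp del: powr_gt_zero)
    then show ?thesis using T split by (simp add: mult_right_mono)
  qed
qed

lemma comparableI:
  assumes "C > 0" "inverse C \<le> c" "0 \<le> y" "c * y \<le> x" "x \<le> K * y" "K \<le> C"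
  shows "comparable C x y"
  using mult_right_mono[OF assms(2,3)] mult_right_mono[OF assms(6,3)] assms
  unfolding comparable_def by linarith

theorem lemma3p4:
  fixes \<gamma> \<phi> c0 :: real
  assumes "\<gamma> > 1" and "\<phi> = 2 / (1 + \<gamma>)" and "c0 > 0"
  shows "\<exists>R0>3. \<forall>R\<ge>R0. \<exists>C>0. \<forall>lam\<ge>c0. \<forall>r\<in>{R, - R}. \<forall>W :: real \<Rightarrow> real.
           W_solution \<gamma> lam r W \<longrightarrow>
           (\<forall>t\<in>{0..3}.
              (t \<le> lam powr ((1 + \<gamma>) / (1 - \<gamma>)) \<longrightarrow> comparable C (W t) (t powr \<phi>)) \<and>
              (lam powr ((1 + \<gamma>) / (1 - \<gamma>)) \<le> t \<and> t \<le> 1 \<longrightarrow> comparable C (W t) (lam * t)) \<and>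
              (1 \<le> t \<longrightarrow> comparable C (W t) lam))"
proof -
  obtain c K where c: "c > 0" and K: "K > 0" and bounds:
    "\<And>lam r W t. \<lbrakk>W_solution \<gamma> lam r W; lam \<ge> c0; \<bar>r\<bar> \<ge> 6; 0 \<le> t; t \<le> 3\<rbrakk> \<Longrightarrow>
       c * t powr \<phi> \<le> W t \<and> lam * t / 9 \<le> W t \<and> W t \<le> K * t powr \<phi> + lam * t"
    using W_solution_bounds[OF assms] by blast
  define C where "C = max (max (inverse c) 9) (max (K + 1) (K * 3 powr \<phi> / c0 + 3))"
  have C: "C > 0" "C \<ge> 9" "C \<ge> K + 1" "C \<ge> K * 3 powr \<phi> / c0 + 3" "C \<ge> inverse c"
    unfolding C_def by auto
  have inverse_C: "inverse C \<le> c" "inverse C \<le> 1 / 9"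
    using C c le_imp_inverse_le[of "inverse c" C] le_imp_inverse_le[of 9 C] by auto
  have \<phi>0: "\<phi> > 0" using assms by simp
  have main: "(t \<le> lam powr ((1 + \<gamma>) / (1 - \<gamma>)) \<longrightarrow> comparable C (W t) (t powr \<phi>)) \<and>
      (lam powr ((1 + \<gamma>) / (1 - \<gamma>)) \<le> t \<and> t \<le> 1 \<longrightarrow> comparable C (W t) (lam * t)) \<and>
      (1 \<le> t \<longrightarrow> comparable C (W t) lam)"
    if W: "W_solution \<gamma> lam r W" and lam: "lam \<ge> c0" and r: "\<bar>r\<bar> \<ge> 6" and t: "0 \<le> t" "t \<le> 3"
    for lam r W t
  proof (intro conjI impI)
    have lam0: "lam > 0" using lam assms(3) by simp
    have b: "c * t powr \<phi> \<le> W t" "1 / 9 * (lam * t) \<le> W t" "W t \<le> K * t powr \<phi> + lam * t"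
      using bounds[OF W lam r t] by auto
    show "comparable C (W t) (t powr \<phi>)" if "t \<le> lam powr ((1 + \<gamma>) / (1 - \<gamma>))"
    proof (rule comparableI[OF C(1) inverse_C(1) _ b(1) _ C(3)])
      show "W t \<le> (K + 1) * t powr \<phi>"
        using b(3) crossover(1)[OF assms(1,2) lam0 t(1) that] by (simp add: algebra_simps)
    qed simp
    show "comparable C (W t) (lam * t)" if "lam powr ((1 + \<gamma>) / (1 - \<gamma>)) \<le> t \<and> t \<le> 1"
    proof (rule comparableI[OF C(1) inverse_C(2) _ b(2) _ C(3)])
      have "K * t powr \<phi> \<le> K * (lam * t)"
        using crossover(2)[OF assms(1,2) lam0 t(1)] that K by (intro mult_left_mono) auto
      then show "W t \<le> (K + 1) * (lam * t)"
        using b(3) by (simp add: algebra_simps)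
    qed (use lam0 t in simp)
    show "comparable C (W t) lam" if "1 \<le> t"
    proof (rule comparableI[OF C(1) inverse_C(2) _ _ _ C(4)])
      show "1 / 9 * lam \<le> W t" using b(2) mult_left_mono[OF that, of lam] lam0 by linarith
      have "K * t powr \<phi> \<le> K * 3 powr \<phi>"
        using t K \<phi>0 by (intro mult_left_mono powr_mono2) auto
      also have "\<dots> \<le> K * 3 powr \<phi> / c0 * lam"
        using lam assms(3) K mult_left_mono[of c0 lam "K * 3 powr \<phi>"] by (simp add: field_simps)
      finally show "W t \<le> (K * 3 powr \<phi> / c0 + 3) * lam"
        using b(3) mult_left_mono[OF t(2), of lam] lam0 unfolding distrib_right by linarith
    qed (use lam0 in simp)
  qed
  show ?thesis
    by (rule exI[of _ 6], intro conjI allI impI exI[of _ C] ballI)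
      (use C(1) main in auto)
qed

end
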